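(* Let $\tau\in(0,1]$. No deterministic algorithm for MinSet under stochastic explorable uncertainty has a competitive ratio better than $1/\tau$ on the class of instances with balancing parameter $\tau$, even if all sets in $\mathcal{S}$ are pairwise disjoint and the distributions $d_i$ are known to the algorithm. That is, for every deterministic algorithm $\mathrm{ALG}$ (which may use the distributions), $\sup_J \mathbb{E}[\mathrm{ALG}(J)]/\mathbb{E}[\mathrm{OPT}(J)]\ge 1/\tau$, where the supremum ranges over such instances $J$.
   Context: An instance of MinSet under stochastic explorable uncertainty consists of a finite set of uncertainty intervals $\mathcal{I}=\{I_1,\dots,I_n\}$ and a family $\mathcal{S}=\{S_1,\dots,S_m\}$ of subsets of $\mathcal{I}$. Each interval is either open, $I_i=(L_i,U_i)$ with $L_i<U_i$, or trivial, $I_i=\{w_i\}$ with $L_i=U_i=w_i$. Each $I_i$ has a value $w_i\in I_i$, drawn independently according to a distribution $d_i$ on $I_i$; initially the values of non-trivial intervals are unknown, and querying $I_i$ reveals $w_i$. For $S\in\mathcal{S}$ let $w(S)=\sum_{I_i\in S}w_i$, and for a set $Q\subseteq\mathcal{I}$ of queried intervals let $L_S(Q)=\sum_{I_i\in S\setminus Q}L_i+\sum_{I_i\in S\cap Q}w_i$ and $U_S(Q)=\sum_{I_i\in S\setminus Q}U_i+\sum_{I_i\in S\cap Q}w_i$. Let $w^*=\min_{S\in\mathcal{S}}w(S)$. A set $Q\subseteq\mathcal{I}$ is feasible (solves the instance) if there is $S^*\in\mathcal{S}$ with $L_{S^*}(Q)=U_{S^*}(Q)=w^*$ and $L_S(Q)\ge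 w^*$ for all $S\in\mathcal{S}$. An algorithm adaptively queries intervals (each choice may depend on earlier query results) until its set of queried intervals is feasible; $\mathrm{ALG}(J)$ is the number of queries it makes on instance $J$, and $\mathrm{OPT}(J)$ is the minimum cardinality of a feasible set for the realized values. The competitive ratio of an algorithm on a class of instances is $\sup_J \mathbb{E}[\mathrm{ALG}(J)]/\mathbb{E}[\mathrm{OPT}(J)]$. For each $I_i$ let $\tau_i=\Pr[w_i\ge (U_i+L_i)/2]$; the balancing parameter of the instance is $\tau=\min_{I_i\in\mathcal{I}}\tau_i$. *)

theory Defs
  imports "HOL-Probability.Probability"
begin

text \<open>
  The uncertainty intervals are an indexed family with index set \<open>{1..num_ivs J}\<close>; a set of
  intervals is represented by the set of its indices, so two different indices may carry the same
  interval. Values of the record functions outside the index set are irrelevant.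
\<close>

record minset =
  num_ivs :: nat
  lower :: "nat \<Rightarrow> real"
  upper :: "nat \<Rightarrow> real"
  family :: "nat set set"
  dist_of :: "nat \<Rightarrow> real measure"

definition indices :: "minset \<Rightarrow> nat set" where
  "indices J = {1..num_ivs J}"

definition interval :: "minset \<Rightarrow> nat \<Rightarrow> real set" where
  "interval J i = (if lower J i = upper J i then {lower J i} else {lower J i<..<upper J i})"

definition minset_instance :: "minset \<Rightarrow> bool" where
  "minset_instance J \<longleftrightarrow>
     num_ivs J \<ge> 1 \<and>
     (\<forall>i\<in>indices J. lower J i \<le> upper J i) \<and>
     family J \<noteq> {} \<and> family J \<subseteq> Pow (indices J) \<and>
     (\<forall>i\<in>indices J. prob_space (dist_of J i) \<and>
        sets (dist_of J i) = sets (restrict_space borel (interval J i)))"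

definition realizations :: "minset \<Rightarrow> (nat \<Rightarrow> real) measure" where
  "realizations J = (\<Pi>\<^sub>M i\<in>indices J. dist_of J i)"

definition set_value :: "(nat \<Rightarrow> real) \<Rightarrow> nat set \<Rightarrow> real" where
  "set_value w S = (\<Sum>i\<in>S. w i)"

definition lower_limit :: "minset \<Rightarrow> (nat \<Rightarrow> real) \<Rightarrow> nat set \<Rightarrow> nat set \<Rightarrow> real" where
  "lower_limit J w Q S = (\<Sum>i\<in>S - Q. lower J i) + (\<Sum>i\<in>S \<inter> Q. w i)"

definition upper_limit :: "minset \<Rightarrow> (nat \<Rightarrow> real) \<Rightarrow> nat set \<Rightarrow> nat set \<Rightarrow> real" where
  "upper_limit J w Q S = (\<Sum>i\<in>S - Q. upper J i) + (\<Sum>i\<in>S \<inter> Q. w i)"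

definition min_value :: "minset \<Rightarrow> (nat \<Rightarrow> real) \<Rightarrow> real" where
  "min_value J w = Min (set_value w ` family J)"

definition feasible :: "minset \<Rightarrow> (nat \<Rightarrow> real) \<Rightarrow> nat set \<Rightarrow> bool" where
  "feasible J w Q \<longleftrightarrow>
     Q \<subseteq> indices J \<and>
     (\<exists>S\<in>family J. lower_limit J w Q S = min_value J w \<and> upper_limit J w Q S = min_value J w) \<and>
     (\<forall>S\<in>family J. lower_limit J w Q S \<ge> min_value J w)"

definition OPT :: "minset \<Rightarrow> (nat \<Rightarrow> real) \<Rightarrow> nat" where
  "OPT J w = Min (card ` {Q. feasible J w Q})"

text \<open>
  A deterministic algorithm maps the instance (including all distributions) and the list of
  queries made so far, with the revealed values, to the index of the next interval to query.
\<close>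

type_synonym query_alg = "minset \<Rightarrow> (nat \<times> real) list \<Rightarrow> nat"

definition deterministic_algorithm :: "query_alg \<Rightarrow> bool" where
  "deterministic_algorithm A \<longleftrightarrow> (\<forall>J h. minset_instance J \<longrightarrow> A J h \<in> indices J)"

primrec history :: "query_alg \<Rightarrow> minset \<Rightarrow> (nat \<Rightarrow> real) \<Rightarrow> nat \<Rightarrow> (nat \<times> real) list" where
  "history A J w 0 = []"
| "history A J w (Suc k) =
     (let h = history A J w k; q = A J h in h @ [(q, w q)])"

definition queried :: "query_alg \<Rightarrow> minset \<Rightarrow> (nat \<Rightarrow> real) \<Rightarrow> nat \<Rightarrow> nat set" where
  "queried A J w k = fst ` set (history A J w k)"

text \<open>
  The number of queries until the queried set is feasible; the infimum of the empty set is
  \<open>\<infinity>\<close>, which covers an algorithm that keeps repeating queries and never gets there.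
\<close>

definition ALG :: "query_alg \<Rightarrow> minset \<Rightarrow> (nat \<Rightarrow> real) \<Rightarrow> enat" where
  "ALG A J w = Inf (enat ` {k. feasible J w (queried A J w k)})"

text \<open>
  No measurability is imposed on algorithms. For a non-measurable integrand the nonnegative
  integral is the lower integral, so it never exceeds any other notion of expectation.
\<close>

definition expected_ALG :: "query_alg \<Rightarrow> minset \<Rightarrow> ennreal" where
  "expected_ALG A J = (\<integral>\<^sup>+ w. ennreal_of_enat (ALG A J w) \<partial>realizations J)"

definition expected_OPT :: "minset \<Rightarrow> ennreal" where
  "expected_OPT J = (\<integral>\<^sup>+ w. of_nat (OPT J w) \<partial>realizations J)"

definition tau_of :: "minset \<Rightarrow> nat \<Rightarrow> real" where
  "tau_of J i = measure (dist_of J i)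
     {x \<in> space (dist_of J i). x \<ge> (upper J i + lower J i) / 2}"

definition balancing_parameter :: "minset \<Rightarrow> real" where
  "balancing_parameter J = Min (tau_of J ` indices J)"

text \<open>
  If the expected optimum is 0, the empty set is feasible almost surely and the algorithm makes no
  query almost surely; such instances contribute \<open>0 / 0 = 0\<close> to the supremum.
\<close>

definition competitive_ratio :: "query_alg \<Rightarrow> minset set \<Rightarrow> ennreal" where
  "competitive_ratio A C = (SUP J\<in>C. expected_ALG A J / expected_OPT J)"

end

theory Submission
  imports Defs
begin

text \<open>
  One set is a single trivial interval of value \<open>1/2\<close>; the other consists of \<open>n\<close> intervals \<open>(0,1)\<close>
  whose values are \<open>1/2\<close> with probability \<open>\<tau>\<close> and otherwise so small that \<open>n\<close> of them still sum to
  less than \<open>1/2\<close>. A query set is feasible as soon as it contains one interval of value \<open>1/2\<close>, so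
  the optimum is \<open>1\<close> unless all values are small, which has probability \<open>(1 - \<tau>) ^ n\<close>. An algorithm,
  however, sees independent trials with success probability \<open>\<tau>\<close>: the queries it makes while
  only small values show up form a fixed sequence, so it needs more than \<open>k < n\<close> queries with
  probability at least \<open>(1 - \<tau>) ^ k\<close>. The expected number of queries is therefore at least
  \<open>(\<Sum>k<n. (1 - \<tau>) ^ k)\<close>, which tends to \<open>1 / \<tau>\<close>.
\<close>

section \<open>The hard instances and their balancing parameter\<close>

definition hard_value :: "nat \<Rightarrow> nat \<Rightarrow> bool \<Rightarrow> real" where
  "hard_value n i b = (if i \<le> n \<and> \<not> b then 1 / (2 * (real n + 1)) else 1 / 2)"

text \<open>Each distribution is the push-forward of a biased coin along \<open>hard_value\<close>,
  with \<open>True\<close> giving the large value. On the trivial interval both outcomes give 1/2,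
  so all indices are handled alike. The target is the Borel algebra of the interval itself, as
  \<open>minset_instance\<close> demands.\<close>

definition hard_instance :: "real \<Rightarrow> nat \<Rightarrow> minset" where
  "hard_instance \<tau> n =
     \<lparr>num_ivs = Suc n,
      lower = (\<lambda>i. if i \<le> n then 0 else 1 / 2),
      upper = (\<lambda>i. if i \<le> n then 1 else 1 / 2),
      family = {{1..n}, {Suc n}},
      dist_of = (\<lambda>i. distr (measure_pmf (bernoulli_pmf \<tau>))
        (restrict_space borel (if i \<le> n then {0<..<1} else {1 / 2})) (hard_value n i))\<rparr>"

lemma hard_instance_sel [simp]:
  "num_ivs (hard_instance \<tau> n) = Suc n"
  "lower (hard_instance \<tau> n) i = (if i \<le> n then 0 else 1 / 2)"
  "upper (hard_instance \<tau> n) i = (if i \<le> n then 1 else 1 / 2)"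
  "family (hard_instance \<tau> n) = {{1..n}, {Suc n}}"
  "indices (hard_instance \<tau> n) = {1..Suc n}"
  "interval (hard_instance \<tau> n) i = (if i \<le> n then {0<..<1} else {1 / 2})"
  by (simp_all add: hard_instance_def indices_def interval_def)

lemma dist_of_hard_instance:
  "dist_of (hard_instance \<tau> n) i =
     distr (measure_pmf (bernoulli_pmf \<tau>))
       (restrict_space borel (interval (hard_instance \<tau> n) i)) (hard_value n i)"
  unfolding hard_instance_sel by (simp add: hard_instance_def)

lemma hard_value_in_interval: "hard_value n i b \<in> interval (hard_instance \<tau> n) i"
  by (auto simp: hard_value_def field_simps)

lemma hard_value_measurable:
  "hard_value n i \<in> measurable (measure_pmf p)
     (restrict_space borel (interval (hard_instance \<tau> n) i))"
  using hard_value_in_interval by (auto simp: space_restrict_space simp del: hard_instance_sel)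

lemma sets_dist_of_hard_instance:
  "sets (dist_of (hard_instance \<tau> n) i) =
     sets (restrict_space borel (interval (hard_instance \<tau> n) i))"
  by (simp add: dist_of_hard_instance del: hard_instance_sel)

lemma space_dist_of_hard_instance:
  "space (dist_of (hard_instance \<tau> n) i) = interval (hard_instance \<tau> n) i"
  by (simp add: dist_of_hard_instance space_restrict_space del: hard_instance_sel)

lemma prob_space_dist_of_hard_instance: "prob_space (dist_of (hard_instance \<tau> n) i)"
  unfolding dist_of_hard_instance
  by (rule measure_pmf.prob_space_distr) (rule hard_value_measurable)

lemma emeasure_dist_of_hard_instance:
  assumes "B \<in> sets borel"
  shows "emeasure (dist_of (hard_instance \<tau> n) i) (B \<inter> interval (hard_instance \<tau> n) i) =
    emeasure (measure_pmf (bernoulli_pmf \<tau>)) {b. hard_value n i b \<in> B}"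
proof -
  have "interval (hard_instance \<tau> n) i \<in> sets borel"
    by simp
  then have "B \<inter> interval (hard_instance \<tau> n) i \<in>
      sets (restrict_space borel (interval (hard_instance \<tau> n) i))"
    using assms by (subst sets_restrict_space_iff) (auto simp del: hard_instance_sel)
  then show ?thesis
    unfolding dist_of_hard_instance
    by (subst emeasure_distr[OF hard_value_measurable])
      (auto simp: hard_value_in_interval vimage_def simp del: hard_instance_sel)
qed

lemma emeasure_bernoulli_False:
  assumes "0 \<le> \<tau>" "\<tau> \<le> 1"
  shows "emeasure (measure_pmf (bernoulli_pmf \<tau>)) {False} = ennreal (1 - \<tau>)"
  using assms by (simp add: emeasure_pmf_single)

lemma minset_instance_hard_instance: "minset_instance (hard_instance \<tau> n)"
  unfolding minset_instance_def
  using prob_space_dist_of_hard_instance sets_dist_of_hard_instance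
  by (auto simp del: hard_instance_sel(6))

lemma disjoint_family_hard_instance: "disjoint (family (hard_instance \<tau> n))"
  by (auto simp: disjoint_def)

lemma balancing_parameter_hard_instance:
  assumes "0 \<le> \<tau>" "\<tau> \<le> 1" "n \<ge> 1"
  shows "balancing_parameter (hard_instance \<tau> n) = \<tau>"
proof -
  let ?J = "hard_instance \<tau> n"
  have tau_eq: "tau_of ?J i = (if i \<le> n then \<tau> else 1)" for i
  proof -
    have "tau_of ?J i = measure (dist_of ?J i) ({1 / 2..} \<inter> interval ?J i)"
      unfolding tau_of_def space_dist_of_hard_instance
      by (rule arg_cong[where f = "measure _"]) auto
    also have "\<dots> = measure (measure_pmf (bernoulli_pmf \<tau>)) {b. hard_value n i b \<in> {1 / 2..}}"
      unfolding measure_def by (subst emeasure_dist_of_hard_instance) auto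
    \<comment> \<open>All intervals have midpoint 1/2. The large value sits exactly on it and
      counts; the small value is strictly below it because \<open>n \<ge> 1\<close>.\<close>
    also have "{b. hard_value n i b \<in> {1 / 2..}} = (if i \<le> n then {True} else UNIV)"
      using assms(3) by (auto simp: hard_value_def field_simps)
    finally show ?thesis
      using assms by (simp add: measure_pmf_single)
  qed
  have "tau_of ?J ` indices ?J = {\<tau>, 1}"
  proof
    show "{\<tau>, 1} \<subseteq> tau_of ?J ` indices ?J"
      using assms(3) imageI[of 1 "indices ?J" "tau_of ?J"]
        imageI[of "Suc n" "indices ?J" "tau_of ?J"] by (simp add: tau_eq)
  qed (auto simp: tau_eq)
  then show ?thesis
    using assms by (simp add: balancing_parameter_def)
qed

section \<open>Probabilities of boxes of realizations\<close>

lemma space_realizations_hard_instance: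
  "space (realizations (hard_instance \<tau> n)) =
     (\<Pi>\<^sub>E i\<in>{1..Suc n}. interval (hard_instance \<tau> n) i)"
  by (simp add: realizations_def space_PiM space_dist_of_hard_instance del: hard_instance_sel(6))

lemma prob_space_realizations_hard_instance: "prob_space (realizations (hard_instance \<tau> n))"
  unfolding realizations_def
  by (rule prob_space_PiM) (rule prob_space_dist_of_hard_instance)

text \<open>Independence turns the probability of a box into a product of coin probabilities. Each
  side is cut down to the interval because that is the whole space of the component.\<close>

lemma
  assumes "\<And>i. B i \<in> sets borel"
  shows emeasure_realizations_hard_instance:
    "emeasure (realizations (hard_instance \<tau> n))
       (\<Pi>\<^sub>E i\<in>{1..Suc n}. B i \<inter> interval (hard_instance \<tau> n) i) =
     (\<Prod>i = 1..Suc n. emeasure (measure_pmf (bernoulli_pmf \<tau>)) {b. hard_value n i b \<in> B i})"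
    and sets_realizations_hard_instance:
    "(\<Pi>\<^sub>E i\<in>{1..Suc n}. B i \<inter> interval (hard_instance \<tau> n) i)
       \<in> sets (realizations (hard_instance \<tau> n))"
proof -
  let ?J = "hard_instance \<tau> n"
  interpret product_prob_space "dist_of ?J"
    by (simp add: product_prob_space_def product_prob_space_axioms_def product_sigma_finite_def
        prob_space_dist_of_hard_instance prob_space_imp_sigma_finite)
  have sets: "B i \<inter> interval ?J i \<in> sets (dist_of ?J i)" for i
    using assms[of i] unfolding sets_dist_of_hard_instance
    by (subst sets_restrict_space_iff) auto
  then show "(\<Pi>\<^sub>E i\<in>{1..Suc n}. B i \<inter> interval ?J i) \<in> sets (realizations ?J)"
    unfolding realizations_def hard_instance_sel(5) by (intro sets_PiM_I_finite) auto
  show "emeasure (realizations ?J) (\<Pi>\<^sub>E i\<in>{1..Suc n}. B i \<inter> interval ?J i) =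
      (\<Prod>i = 1..Suc n. emeasure (measure_pmf (bernoulli_pmf \<tau>)) {b. hard_value n i b \<in> B i})"
    unfolding realizations_def hard_instance_sel(5)
    by (subst emeasure_PiM[OF _ sets])
      (simp_all add: emeasure_dist_of_hard_instance assms del: hard_instance_sel(6))
qed

section \<open>Upper bound on the expected optimum\<close>

lemma OPT_le_card:
  assumes "feasible J w Q"
  shows "OPT J w \<le> card Q"
proof -
  have "{Q. feasible J w Q} \<subseteq> Pow (indices J)"
    by (auto simp: feasible_def)
  \<comment> \<open>\<open>Min\<close> in \<open>OPT\<close> is a true minimum only over a finite
    set.\<close>
  then have "finite {Q. feasible J w Q}"
    by (rule finite_subset) (simp add: indices_def)
  then show ?thesis
    unfolding OPT_def using assms by (intro Min_le) auto
qed

lemma feasible_indices: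
  assumes "minset_instance J"
  shows "feasible J w (indices J)"
proof -
  have fam: "family J \<subseteq> Pow (indices J)" "family J \<noteq> {}"
    using assms by (auto simp: minset_instance_def)
  then have fin: "finite (family J)"
    by (auto simp: indices_def intro: finite_subset)
  have lims: "lower_limit J w (indices J) S = set_value w S"
      "upper_limit J w (indices J) S = set_value w S" if "S \<in> family J" for S
  proof -
    have "S - indices J = {}" "S \<inter> indices J = S"
      using fam that by auto
    then show "lower_limit J w (indices J) S = set_value w S"
      "upper_limit J w (indices J) S = set_value w S"
      by (simp_all only: lower_limit_def upper_limit_def set_value_def sum.empty add_0)
  qed
  have "min_value J w \<in> set_value w ` family J"
    unfolding min_value_def using fam fin by (intro Min_in) auto
  moreover have "min_value J w \<le> set_value w S" if "S \<in> family J" for S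
    unfolding min_value_def using fin that by (intro Min_le) auto
  ultimately show ?thesis
    by (auto simp: feasible_def lims)
qed

text \<open>The trivial set has both limits equal to 1/2 without any query, and a single revealed
  large value already lifts the lower limit of the other set to 1/2.\<close>

lemma feasible_large_singleton:
  assumes w: "w \<in> space (realizations (hard_instance \<tau> n))"
    and i: "i \<in> {1..n}" "w i \<ge> 1 / 2"
  shows "feasible (hard_instance \<tau> n) w {i}"
proof -
  let ?J = "hard_instance \<tau> n"
  have w_in: "w j \<in> interval ?J j" if "j \<in> {1..Suc n}" for j
    using w that unfolding space_realizations_hard_instance by blast
  have trivial: "w (Suc n) = 1 / 2"
    using w_in[of "Suc n"] by simp
  have nonneg: "0 \<le> w j" if "j \<in> {1..n}" for j
    using w_in[of j] that by auto
  have "w i \<le> (\<Sum>j = 1..n. w j)"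
    using i nonneg by (intro member_le_sum) auto
  then have min_eq: "min_value ?J w = 1 / 2"
    using i by (simp add: min_value_def set_value_def trivial)
  have "{1..n} \<inter> {i} = {i}" "{Suc n} - {i} = {Suc n}" "{Suc n} \<inter> {i} = {}"
    using i by auto
  then show ?thesis
    using i by (simp add: feasible_def min_eq lower_limit_def upper_limit_def)
qed

text \<open>Without a large value, querying everything still works. The crude count
  \<open>Suc n\<close> is harmless, since this case will get weight only
  \<open>(1 - \<tau>) ^ n\<close>.\<close>

lemma OPT_hard_instance_le:
  assumes "w \<in> space (realizations (hard_instance \<tau> n))"
  shows "OPT (hard_instance \<tau> n) w \<le> (if \<exists>i\<in>{1..n}. w i \<ge> 1 / 2 then 1 else Suc n)"
proof (cases "\<exists>i\<in>{1..n}. w i \<ge> 1 / 2")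
  case True
  then obtain i where "i \<in> {1..n}" "w i \<ge> 1 / 2"
    by blast
  then have "OPT (hard_instance \<tau> n) w \<le> card {i}"
    by (intro OPT_le_card feasible_large_singleton[OF assms])
  then show ?thesis
    using True by simp
next
  case False
  have "OPT (hard_instance \<tau> n) w \<le> card (indices (hard_instance \<tau> n))"
    by (intro OPT_le_card feasible_indices minset_instance_hard_instance)
  with False show ?thesis
    by simp
qed

lemma expected_OPT_hard_instance_le:
  assumes "0 \<le> \<tau>" "\<tau> \<le> 1"
  shows "expected_OPT (hard_instance \<tau> n) \<le> ennreal (1 + real (Suc n) * (1 - \<tau>) ^ n)"
proof -
  let ?J = "hard_instance \<tau> n" and ?M = "realizations (hard_instance \<tau> n)"
  interpret prob_space ?M
    by (rule prob_space_realizations_hard_instance)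
  \<comment> \<open>\<open>E\<close> is the event that all \<open>n\<close> nontrivial values are
    small, written as a box; the trivial coordinate contributes the factor 1.\<close>
  define B :: "nat \<Rightarrow> real set" where "B i = (if i \<le> n then {..<1 / 2} else UNIV)" for i
  define E where "E = (\<Pi>\<^sub>E i\<in>{1..Suc n}. B i \<inter> interval ?J i)"
  have B: "B i \<in> sets borel" for i
    by (simp add: B_def)
  have E: "E \<in> sets ?M"
    unfolding E_def by (rule sets_realizations_hard_instance[OF B])
  have "emeasure ?M E =
      (\<Prod>i = 1..Suc n. emeasure (measure_pmf (bernoulli_pmf \<tau>)) {b. hard_value n i b \<in> B i})"
    unfolding E_def by (rule emeasure_realizations_hard_instance[OF B])
  also have "\<dots> = (\<Prod>i = 1..n. emeasure (measure_pmf (bernoulli_pmf \<tau>)) {b. hard_value n i b \<in> B i})"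
    by (simp add: B_def measure_pmf.emeasure_space_1[simplified])
  also have "\<dots> = (\<Prod>i = 1..n. emeasure (measure_pmf (bernoulli_pmf \<tau>)) {False})"
  proof (intro prod.cong refl arg_cong[where f = "emeasure _"])
    fix i assume "i \<in> {1..n}"
    then show "{b. hard_value n i b \<in> B i} = {False}"
      by (auto simp: hard_value_def B_def field_simps)
  qed
  also have "\<dots> = ennreal ((1 - \<tau>) ^ n)"
    using assms by (simp add: emeasure_bernoulli_False ennreal_power del: emeasure_pmf_single)
  finally have prob_E: "emeasure ?M E = ennreal ((1 - \<tau>) ^ n)" .
  have "expected_OPT ?J \<le> (\<integral>\<^sup>+ w. 1 + of_nat (Suc n) * indicator E w \<partial>?M)"
    unfolding expected_OPT_def
  proof (rule nn_integral_mono)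
    fix w assume w: "w \<in> space ?M"
    show "of_nat (OPT ?J w) \<le> 1 + of_nat (Suc n) * (indicator E w :: ennreal)"
    proof (cases "\<exists>i\<in>{1..n}. w i \<ge> 1 / 2")
      case True
      then have "OPT ?J w \<le> 1"
        using OPT_hard_instance_le[OF w] by simp
      then have "of_nat (OPT ?J w) \<le> (of_nat 1 :: ennreal)"
        by (simp only: of_nat_le_iff)
      also have "\<dots> \<le> 1 + of_nat (Suc n) * (indicator E w :: ennreal)"
        by simp
      finally show ?thesis .
    next
      case False
      have "OPT ?J w \<le> Suc n"
        using OPT_hard_instance_le[OF w] False by simp
      then have "of_nat (OPT ?J w) \<le> (of_nat (Suc n) :: ennreal)"
        by (simp only: of_nat_le_iff)
      also have "w \<in> E"
        using w False unfolding E_def space_realizations_hard_instance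
        by (auto simp: PiE_iff B_def not_le simp del: hard_instance_sel)
      then have "of_nat (Suc n) \<le> 1 + of_nat (Suc n) * (indicator E w :: ennreal)"
        by (simp add: add_increasing)
      finally show ?thesis .
    qed
  qed
  also have "\<dots> = 1 + of_nat (Suc n) * emeasure ?M E"
    using E by (simp add: nn_integral_add nn_integral_cmult_indicator emeasure_space_1)
  also have "\<dots> = ennreal (1 + real (Suc n) * (1 - \<tau>) ^ n)"
    using assms unfolding prob_E
    by (subst ennreal_plus) (simp_all add: ennreal_mult ennreal_of_nat_eq_real_of_nat)
  finally show ?thesis .
qed

section \<open>Runs of an algorithm that sees only small values\<close>

lemma history_cong:
  assumes "\<And>i. i \<in> queried A J w k \<Longrightarrow> w' i = w i"
  shows "history A J w' k = history A J w k"
  using assms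
proof (induction k)
  case (Suc k)
  then have "history A J w' k = history A J w k"
    by (simp add: queried_def Let_def)
  \<comment> \<open>Equal histories force the same next query, and the two realizations agree
    there.\<close>
  moreover have "w' (A J (history A J w k)) = w (A J (history A J w k))"
    using Suc.prems by (simp add: queried_def Let_def)
  ultimately show ?case
    by (simp add: Let_def)
qed simp

text \<open>Only an inequality, as an algorithm may repeat queries.\<close>

lemma card_queried_le: "card (queried A J w k) \<le> k"
proof -
  have "length (history A J w k) = k"
    by (induction k) (simp_all add: Let_def)
  then show ?thesis
    unfolding queried_def by (metis card_image_le card_length le_trans List.finite_set)
qed

lemma queried_subset_indices:
  assumes "deterministic_algorithm A" "minset_instance J"
  shows "queried A J w k \<subseteq> indices J"
proof (induction k)
  case (Suc k)
  then show ?case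
    using assms by (simp add: queried_def Let_def deterministic_algorithm_def)
qed (simp add: queried_def)

text \<open>Neither set can serve as the witness of feasibility: \<open>{1..n}\<close> still has an
  unqueried interval, which separates its limits, and \<open>{Suc n}\<close> has value 1/2, which
  exceeds the current lower limit of \<open>{1..n}\<close>.\<close>

lemma not_feasible_small_values:
  assumes "card Q < n" and "finite Q"
    and small: "\<And>i. i \<in> Q \<Longrightarrow> w i = hard_value n i False"
    and trivial: "w (Suc n) = 1 / 2"
  shows "\<not> feasible (hard_instance \<tau> n) w Q"
proof
  let ?J = "hard_instance \<tau> n"
  assume "feasible ?J w Q"
  then consider "lower_limit ?J w Q {1..n} = upper_limit ?J w Q {1..n}"
    | "min_value ?J w = lower_limit ?J w Q {Suc n}" "lower_limit ?J w Q {1..n} \<ge> min_value ?J w"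
    by (auto simp: feasible_def)
  then show False
  proof cases
    case 1
    have "{1..n} - Q \<noteq> {}"
      using assms card_mono[of Q "{1..n}"] by auto
    then show False
      using 1 by (simp add: lower_limit_def upper_limit_def)
  next
    case 2
    have "min_value ?J w = 1 / 2"
      unfolding 2(1) lower_limit_def using trivial by (cases "Suc n \<in> Q") (auto simp: insert_Diff_if)
    \<comment> \<open>Unqueried intervals contribute their lower end 0. Even \<open>n\<close> small
      values sum to only \<open>n / (2 * (n + 1))\<close>, which is below 1/2.\<close>
    moreover have "lower_limit ?J w Q {1..n} = (\<Sum>i\<in>{1..n} \<inter> Q. 1 / (2 * (real n + 1)))"
      by (simp add: lower_limit_def small hard_value_def)
    moreover have "\<dots> \<le> (\<Sum>i\<in>{1..n}. 1 / (2 * (real n + 1)))"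
      by (intro sum_mono2) auto
    moreover have "\<dots> < 1 / 2"
      by (simp add: field_simps)
    ultimately show False
      using 2 by linarith
  qed
qed

lemma queried_mono: "k \<le> l \<Longrightarrow> queried A J w k \<subseteq> queried A J w l"
  by (rule lift_Suc_mono_le[of "queried A J w"]) (auto simp: queried_def Let_def)

text \<open>The reference run is the one on the all-small realization. If \<open>w\<close> agrees
  with it on the first \<open>k\<close> queries, both runs query the same sets up to step
  \<open>k\<close>, and none of these sets is feasible.\<close>

lemma ALG_gt_if_small_values:
  assumes "k < n"
    and small: "\<And>i. i \<in> queried A (hard_instance \<tau> n) (\<lambda>i. hard_value n i False) k \<Longrightarrow>
      w i = hard_value n i False"
    and trivial: "w (Suc n) = 1 / 2"
  shows "ALG A (hard_instance \<tau> n) w > enat k"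
proof -
  let ?J = "hard_instance \<tau> n" and ?v = "\<lambda>i. hard_value n i False"
  have "\<not> feasible ?J w (queried A ?J w j)" if "j \<le> k" for j
  proof -
    have small_j: "w i = ?v i" if "i \<in> queried A ?J ?v j" for i
      using small queried_mono[OF \<open>j \<le> k\<close>] that by blast
    have eq: "queried A ?J w j = queried A ?J ?v j"
      using history_cong[of A ?J ?v j w] small_j by (simp add: queried_def)
    show ?thesis
      unfolding eq
    proof (rule not_feasible_small_values)
      show "card (queried A ?J ?v j) < n"
        using card_queried_le[of A ?J ?v j] \<open>j \<le> k\<close> \<open>k < n\<close> by linarith
    qed (use small_j trivial in \<open>auto simp: queried_def\<close>)
  qed
  then have "enat (Suc k) \<le> ALG A ?J w"
    unfolding ALG_def by (intro Inf_greatest) (auto simp: not_le[symmetric] Suc_le_eq)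
  then show ?thesis
    by (metis enat_ord_simps(2) lessI less_le_trans)
qed

text \<open>A tail-sum bound: the number of \<open>k < n\<close> with \<open>ALG > k\<close> is at
  most \<open>ALG\<close>. Each tail event is replaced by a box \<open>E k\<close> contained in it,
  so the minorant is measurable even if \<open>ALG\<close> is not.\<close>

lemma expected_ALG_hard_instance_ge:
  assumes "0 \<le> \<tau>" "\<tau> \<le> 1" and "deterministic_algorithm A"
  shows "expected_ALG A (hard_instance \<tau> n) \<ge> ennreal (\<Sum>k<n. (1 - \<tau>) ^ k)"
proof -
  let ?J = "hard_instance \<tau> n" and ?M = "realizations (hard_instance \<tau> n)"
  let ?v = "\<lambda>i. hard_value n i False"
  \<comment> \<open>\<open>D k\<close> comes from the reference run and does not depend on
    \<open>w\<close>; this is what makes \<open>E k\<close> a box.\<close>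
  define D where "D k = queried A ?J ?v k" for k
  define B where "B k i = (if i \<in> D k then {?v i} else UNIV)" for k i
  define E where "E k = (\<Pi>\<^sub>E i\<in>{1..Suc n}. B k i \<inter> interval ?J i)" for k
  have B: "B k i \<in> sets borel" for k i
    by (simp add: B_def)
  have E: "E k \<in> sets ?M" for k
    unfolding E_def by (rule sets_realizations_hard_instance[OF B])
  have D_sub: "D k \<subseteq> {1..Suc n}" for k
    using queried_subset_indices[OF assms(3) minset_instance_hard_instance] by (simp add: D_def)
  have prob_E: "ennreal ((1 - \<tau>) ^ k) \<le> emeasure ?M (E k)" for k
  proof -
    \<comment> \<open>Repeated queries make \<open>D k\<close> smaller and the event only more
      likely.\<close>
    have "ennreal ((1 - \<tau>) ^ k) \<le> ennreal ((1 - \<tau>) ^ card (D k))"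
      using assms card_queried_le[of A ?J ?v k]
      by (intro ennreal_leI power_decreasing) (auto simp: D_def)
    also have "\<dots> = (\<Prod>i\<in>D k. emeasure (measure_pmf (bernoulli_pmf \<tau>)) {False})"
      using assms by (simp add: emeasure_bernoulli_False ennreal_power del: emeasure_pmf_single)
    also have "\<dots> = (\<Prod>i = 1..Suc n.
        if i \<in> D k then emeasure (measure_pmf (bernoulli_pmf \<tau>)) {False} else 1)"
      using D_sub[of k] by (simp only: prod.inter_restrict[symmetric] Int_absorb1 finite_atLeastAtMost)
    \<comment> \<open>Not an equality in general: \<open>D k\<close> may contain
      \<open>Suc n\<close>, where the required value is certain.\<close>
    also have "\<dots> \<le> (\<Prod>i = 1..Suc n.
        emeasure (measure_pmf (bernoulli_pmf \<tau>)) {b. hard_value n i b \<in> B k i})"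
    proof (rule prod_mono_ennreal)
      fix i
      show "(if i \<in> D k then emeasure (measure_pmf (bernoulli_pmf \<tau>)) {False} else 1)
          \<le> emeasure (measure_pmf (bernoulli_pmf \<tau>)) {b. hard_value n i b \<in> B k i}"
      proof (cases "i \<in> D k")
        case True
        then show ?thesis
          by (simp del: emeasure_pmf_single) (intro emeasure_mono; simp add: B_def)
      next
        case False
        then show ?thesis
          by (simp add: B_def measure_pmf.emeasure_space_1[simplified])
      qed
    qed
    also have "\<dots> = emeasure ?M (E k)"
      unfolding E_def by (rule emeasure_realizations_hard_instance[OF B, symmetric])
    finally show ?thesis .
  qed
  have "ennreal (\<Sum>k<n. (1 - \<tau>) ^ k) = (\<Sum>k<n. ennreal ((1 - \<tau>) ^ k))"
    using assms by (simp add: sum_ennreal)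
  also have "\<dots> \<le> (\<Sum>k<n. emeasure ?M (E k))"
    by (intro sum_mono prob_E)
  also have "\<dots> = (\<integral>\<^sup>+ w. (\<Sum>k<n. indicator (E k) w) \<partial>?M)"
    using E by (simp add: nn_integral_sum)
  also have "\<dots> \<le> expected_ALG A ?J"
    unfolding expected_ALG_def
  proof (rule nn_integral_mono)
    fix w assume "w \<in> space ?M"
    then have "w (Suc n) \<in> interval ?J (Suc n)"
      unfolding space_realizations_hard_instance by (rule PiE_mem) simp
    then have trivial: "w (Suc n) = 1 / 2"
      by simp
    have gt: "enat k < ALG A ?J w" if "k < n" "w \<in> E k" for k
    proof (rule ALG_gt_if_small_values)
      fix i assume i: "i \<in> queried A ?J ?v k"
      then have "w i \<in> B k i"
        using that(2) D_sub[of k] unfolding E_def D_def[symmetric] by (auto simp: PiE_iff)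
      then show "w i = ?v i"
        using i by (simp add: B_def D_def)
    qed (use that trivial in auto)
    \<comment> \<open>If \<open>ALG\<close> is a finite \<open>m\<close>, every \<open>k\<close>
      counted on the left is below \<open>m\<close>, so there are at most \<open>m\<close> of them.
      For infinite \<open>ALG\<close> the bound is trivial.\<close>
    show "(\<Sum>k<n. indicator (E k) w) \<le> ennreal_of_enat (ALG A ?J w)"
    proof (cases "ALG A ?J w")
      case (enat m)
      have "(\<Sum>k<n. indicator (E k) w) = (of_nat (card {k\<in>{..<n}. w \<in> E k}) :: ennreal)"
        by (simp add: indicator_def sum.If_cases Int_def)
      also have "card {k\<in>{..<n}. w \<in> E k} \<le> card {..<m}"
        using gt by (intro card_mono) (auto simp: enat)
      then have "of_nat (card {k\<in>{..<n}. w \<in> E k}) \<le> (of_nat m :: ennreal)"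
        by (simp only: of_nat_le_iff card_lessThan)
      finally show ?thesis
        by (simp add: enat)
    qed simp
  qed
  finally show ?thesis .
qed

section \<open>The ratio of the bounds and its limit\<close>

lemma inverse_antimono_ennreal:
  fixes a b :: ennreal
  assumes "a \<le> b"
  shows "inverse b \<le> inverse a"
  using assms unfolding less_eq_ennreal.rep_eq inverse_ennreal.rep_eq
  by (intro ereal_inverse_antimono) simp_all

theorem theorem1:
  fixes \<tau> :: real and A :: query_alg
  assumes "0 < \<tau>" and "\<tau> \<le> 1"
    and "deterministic_algorithm A"
  shows "competitive_ratio A
           {J. minset_instance J \<and> balancing_parameter J = \<tau> \<and> disjoint (family J)}
         \<ge> ennreal (1 / \<tau>)"
proof -
  \<comment> \<open>The lower bound on the expected number of queries divided by the upper bound on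
    the expected optimum.\<close>
  define r where
    "r n = (\<Sum>k<n. (1 - \<tau>) ^ k) / (1 + real (Suc n) * (1 - \<tau>) ^ n)" for n
  let ?C = "{J. minset_instance J \<and> balancing_parameter J = \<tau> \<and> disjoint (family J)}"
  have x: "\<bar>1 - \<tau>\<bar> < 1"
    using assms by simp
  \<comment> \<open>Geometric decay beats the linear factor, so the denominator tends to 1 while the
    numerator tends to the geometric series.\<close>
  have "(\<lambda>n. real n * (1 - \<tau>) ^ n + (1 - \<tau>) ^ n) \<longlonglongrightarrow> 0 + 0"
    using x by (intro tendsto_add powser_times_n_limit_0 LIMSEQ_power_zero) auto
  then have "(\<lambda>n. 1 + real (Suc n) * (1 - \<tau>) ^ n) \<longlonglongrightarrow> 1 + 0"
    by (intro tendsto_add tendsto_const) (simp add: algebra_simps)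
  moreover have "(\<lambda>n. \<Sum>k<n. (1 - \<tau>) ^ k) \<longlonglongrightarrow> 1 / (1 - (1 - \<tau>))"
    using geometric_sums[of "1 - \<tau>"] x by (simp add: sums_def)
  ultimately have "r \<longlonglongrightarrow> (1 / (1 - (1 - \<tau>))) / (1 + 0)"
    unfolding r_def by (intro tendsto_divide) auto
  then have lim: "(\<lambda>n. ennreal (r n)) \<longlonglongrightarrow> ennreal (1 / \<tau>)"
    by (intro tendsto_ennrealI) simp
  \<comment> \<open>For \<open>n = 0\<close> only the trivial interval remains, with balancing
    parameter 1; hence the restriction to \<open>n \<ge> 1\<close>, which the limit does not
    notice.\<close>
  have "ennreal (r n) \<le> competitive_ratio A ?C" if "n \<ge> 1" for n
  proof -
    let ?J = "hard_instance \<tau> n"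
    have pos: "0 < 1 + real (Suc n) * (1 - \<tau>) ^ n"
      using assms by (intro add_pos_nonneg) auto
    have "ennreal (r n) =
        ennreal (\<Sum>k<n. (1 - \<tau>) ^ k) / ennreal (1 + real (Suc n) * (1 - \<tau>) ^ n)"
      unfolding r_def using assms pos by (intro divide_ennreal[symmetric] sum_nonneg) auto
    also have "\<dots> \<le> expected_ALG A ?J / expected_OPT ?J"
      unfolding divide_ennreal_def
      using assms by (intro mult_mono expected_ALG_hard_instance_ge
          inverse_antimono_ennreal expected_OPT_hard_instance_le) auto
    also have "\<dots> \<le> competitive_ratio A ?C"
      unfolding competitive_ratio_def
      using assms that minset_instance_hard_instance disjoint_family_hard_instance
        balancing_parameter_hard_instance[of \<tau> n]
      by (intro SUP_upper) simp
    finally show ?thesis .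
  qed
  then show ?thesis
    by (intro LIMSEQ_le_const2[OF lim]) blast
qed

end
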